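(* Let $d\ge1$ be an integer, let $0\le s_j<1$ for $1\le j\le d$, and let $\pi(\beta)=\prod_{j=1}^d2^{s_jd_T(\beta_j)}$, $\beta\in T^d$, be a standard polynomial weight. Let $\varphi:[0,2]^d\to[0,\infty)$ be a function, increasing (i.e. non-decreasing) in each variable, such that $$\int_{[0,2]^d}\frac{\varphi(t_1,\dots,t_d)}{t_1^{1+s_1}\cdots t_d^{1+s_d}}\,dt_1\dots dt_d<+\infty.$$ If $\mu\ge0$ is a Borel measure on $(\partial T)^d$ satisfying $$\mu(Q_\alpha)\le\varphi\big(M(Q_{\alpha_1}),\dots,M(Q_{\alpha_d})\big)\qquad\text{for all }\alpha=(\alpha_1,\dots,\alpha_d)\in T^d,$$ then $\mu$ is a trace measure for the Hardy inequality, i.e. there is a constant $C_\mu<\infty$ such that for every $f:T^d\to[0,\infty)$ $$\int_{\overline{T}^d}(\mathbb{I}f)^2\,d\mu\le C_\mu\sum_{\alpha\in T^d}f(\alpha)^2\pi(\alpha).$$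
   Context: $T$ denotes the (vertex set of the) rooted infinite binary tree with root $o$, in which every vertex has exactly two children. $\partial T$ is the set of infinite descending paths starting at $o$, and $\overline{T}=T\cup\partial T$. For $\alpha,\beta\in T$ write $\alpha\le\beta$ if $\beta$ lies on the geodesic from $o$ to $\alpha$ (so $o$ is the largest element); for $\omega\in\partial T$, $\omega\le\alpha$ means that $\alpha$ is a vertex on the path $\omega$, or $\alpha=\omega$. For $\alpha,\beta\in\overline{T}$, $\alpha\wedge\beta$ is their least common ancestor (with $\alpha\wedge\alpha=\alpha$), and $d_T(\alpha)$ is the number of vertices $\gamma\in T$ with $\gamma\ge\alpha$ (so $d_T(o)=1$, and $d_T(\omega)=\infty$ for $\omega\in\partial T$). $T^d$, $(\partial T)^d$ and $\overline{T}^d$ are the $d$-fold Cartesian products of $T$, $\partial T$ and $\overline{T}$, with the coordinatewise order. $\overline{T}^d$ carries the topology (and Borel sets) of the metric $\delta(\alpha,\beta)=\sum_{j=1}^d\big(2^{-d_T(\alpha_j\wedge\beta_j)}-\tfrac12(2^{-d_T(\alpha_j)}+2^{-d_T(\beta_j)})\big)$, where $2^{-\infty}=0$. For $\alpha\in T^d$, $Q_\alpha=\{\omega\in(\partial T)^d:\omega\le\alpha\}$; similarly, for a vertex $a\in T$, $Q_a=\{\omega\in\partial T:\omega\le a\}$. $M$ is the Borel probability measure on $\partial T$ determined by $M(Q_a)=2^{-d_T(a)+1}$ for $a\in T$. For $f:T^d\to[0,\infty)$, $(\mathbb{I}f)(\alpha)=\sum_{\gamma\in T^d,\gamma\ge\alpha}f(\gamma)\pi(\gamma)$,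 $\alpha\in\overline{T}^d$. A measure on $(\partial T)^d$ is regarded as a measure on $\overline{T}^d$. *)

theory Defs
  imports "HOL-Probability.Probability" "HOL-Library.Sublist" "HOL-Library.Extended_Nat"
begin

text \<open>
  A vertex of \<open>T\<close> is the word of left/right choices leading to it from the root, so the two
  children of \<open>a\<close> are \<open>a @ [False]\<close> and \<open>a @ [True]\<close>, and the geodesic from the root to \<open>a\<close>
  consists of the prefixes of \<open>a\<close>.
\<close>

type_synonym vertex = "bool list"

datatype tbar = Vert vertex | Ray "nat \<Rightarrow> bool"

definition boundary :: "tbar set" where
  "boundary = range Ray"

text \<open>The root is the largest element; \<open>sup\<close> is the least common ancestor, written as a wedge
  in the literature on the Hardy operator.\<close>

instantiation tbar :: ord
begin

fun less_eq_tbar :: "tbar \<Rightarrow> tbar \<Rightarrow> bool" where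
  "Vert a \<le> Vert b \<longleftrightarrow> prefix b a"
| "Ray \<omega> \<le> Vert b \<longleftrightarrow> (\<forall>i<length b. \<omega> i = b ! i)"
| "Ray \<omega> \<le> Ray \<omega>' \<longleftrightarrow> \<omega> = \<omega>'"
| "Vert a \<le> Ray \<omega>' \<longleftrightarrow> False"

definition less_tbar :: "tbar \<Rightarrow> tbar \<Rightarrow> bool" where
  "less_tbar \<alpha> \<beta> \<longleftrightarrow> \<alpha> \<le> \<beta> \<and> \<not> \<beta> \<le> \<alpha>"

instance ..

end

instantiation tbar :: sup
begin

definition sup_tbar :: "tbar \<Rightarrow> tbar \<Rightarrow> tbar" where
  "sup_tbar \<alpha> \<beta> = (LEAST \<gamma>. \<alpha> \<le> \<gamma> \<and> \<beta> \<le> \<gamma>)"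

instance ..

end

lemma le_Ray_iff [simp]: "\<alpha> \<le> Ray \<omega> \<longleftrightarrow> \<alpha> = Ray \<omega>"
  by (cases \<alpha>) auto

lemma Ray_le_prefix:
  assumes "Ray \<omega> \<le> Vert a" "prefix b a" shows "Ray \<omega> \<le> Vert b"
  using assms by (auto simp: prefix_def nth_append)

lemma le_Vert_chain:
  assumes "\<alpha> \<le> Vert a" "\<alpha> \<le> Vert b" "length a \<le> length b"
  shows "prefix a b"
proof (cases \<alpha>)
  case (Vert c)
  with assms show ?thesis by (auto intro: prefix_length_prefix)
next
  case (Ray \<omega>)
  with assms have "take (length a) b = a" by (intro nth_equalityI) auto
  then show ?thesis by (metis take_is_prefix)
qed

instance tbar :: order
proof
  fix x y z :: tbar
  show "x < y \<longleftrightarrow> x \<le> y \<and> \<not> y \<le> x" by (rule less_tbar_def)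
  show "x \<le> x" by (cases x) auto
  show "x \<le> z" if "x \<le> y" "y \<le> z"
    using that
    by (cases x; cases y; cases z) (auto intro: prefix_order.trans simp del: less_eq_tbar.simps(2) simp: Ray_le_prefix)
  show "x = y" if "x \<le> y" "y \<le> x"
    using that by (cases x; cases y) auto
qed

lemma lca_ex:
  fixes \<alpha> \<beta> :: tbar
  shows "\<exists>\<gamma>. (\<alpha> \<le> \<gamma> \<and> \<beta> \<le> \<gamma>) \<and> (\<forall>\<gamma>'. \<alpha> \<le> \<gamma>' \<and> \<beta> \<le> \<gamma>' \<longrightarrow> \<gamma> \<le> \<gamma>')"
proof (cases "\<alpha> = \<beta>")
  case True
  then show ?thesis by auto
next
  case False
  let ?P = "\<lambda>n. \<exists>c. length c = n \<and> \<alpha> \<le> Vert c \<and> \<beta> \<le> Vert c"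
  have P0: "?P 0" by (cases \<alpha>; cases \<beta>) auto
  have "\<exists>N. \<forall>n. ?P n \<longrightarrow> n \<le> N"
  proof (cases \<alpha>)
    case (Vert a)
    then show ?thesis by (auto dest: prefix_length_le)
  next
    case (Ray \<omega>)
    note R = this
    show ?thesis
    proof (cases \<beta>)
      case (Vert b)
      then show ?thesis by (auto dest: prefix_length_le)
    next
      case (Ray \<omega>')
      with R False obtain i where i: "\<omega> i \<noteq> \<omega>' i" by auto
      have "length c \<le> i" if "\<alpha> \<le> Vert c" "\<beta> \<le> Vert c" for c
      proof (rule ccontr)
        assume "\<not> length c \<le> i"
        then have l: "i < length c" by simp
        with that R Ray have "\<omega> i = c ! i" "\<omega>' i = c ! i" by auto
        with i show False by simp
      qed
      then show ?thesis by auto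
    qed
  qed
  then obtain N where N: "\<And>n. ?P n \<Longrightarrow> n \<le> N" by auto
  define n where "n = (GREATEST n. ?P n)"
  have "?P n" unfolding n_def using GreatestI_nat[of ?P 0 N] P0 N by blast
  then obtain c where c: "length c = n" "\<alpha> \<le> Vert c" "\<beta> \<le> Vert c" by auto
  have "Vert c \<le> \<gamma>'" if "\<alpha> \<le> \<gamma>'" "\<beta> \<le> \<gamma>'" for \<gamma>'
  proof (cases \<gamma>')
    case (Vert b)
    with that have "length b \<le> n" unfolding n_def using Greatest_le_nat[of ?P "length b" N] N by blast
    with c that Vert le_Vert_chain[of \<alpha> b c] show ?thesis by auto
  next
    case (Ray \<omega>)
    with that False show ?thesis by simp
  qed
  with c show ?thesis by blast
qed

lemma lca:
  fixes \<alpha> \<beta> :: tbar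
  shows "\<alpha> \<le> sup \<alpha> \<beta>" "\<beta> \<le> sup \<alpha> \<beta>" "\<alpha> \<le> \<gamma> \<Longrightarrow> \<beta> \<le> \<gamma> \<Longrightarrow> sup \<alpha> \<beta> \<le> \<gamma>"
proof -
  obtain \<delta> where \<delta>: "\<alpha> \<le> \<delta> \<and> \<beta> \<le> \<delta>" "\<And>\<gamma>'. \<alpha> \<le> \<gamma>' \<and> \<beta> \<le> \<gamma>' \<Longrightarrow> \<delta> \<le> \<gamma>'"
    using lca_ex by blast
  then have "sup \<alpha> \<beta> = \<delta>"
    unfolding sup_tbar_def by (intro Least_equality) auto
  with \<delta> show "\<alpha> \<le> sup \<alpha> \<beta>" "\<beta> \<le> sup \<alpha> \<beta>" "\<alpha> \<le> \<gamma> \<Longrightarrow> \<beta> \<le> \<gamma> \<Longrightarrow> sup \<alpha> \<beta> \<le> \<gamma>"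
    by auto
qed

instance tbar :: semilattice_sup
  by standard (auto intro: lca)

definition dT :: "tbar \<Rightarrow> enat" where
  "dT \<alpha> = (if finite {c. \<alpha> \<le> Vert c} then enat (card {c. \<alpha> \<le> Vert c}) else \<infinity>)"

lemma dT_Vert [simp]: "dT (Vert a) = enat (length a + 1)"
proof -
  have *: "{c. Vert a \<le> Vert c} = set (prefixes a)" by auto
  have "card (set (prefixes a)) = length a + 1"
    using distinct_card[OF distinct_prefixes[of a]] by simp
  then show ?thesis by (simp add: dT_def * del: less_eq_tbar.simps)
qed

lemma dT_Ray [simp]: "dT (Ray \<omega>) = \<infinity>"
proof -
  have "inj (\<lambda>n. map \<omega> [0..<n])"
    by (rule injI) (metis length_map length_upt diff_zero)
  then have "infinite (range (\<lambda>n. map \<omega> [0..<n]))" by (simp add: finite_image_iff)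
  moreover have "range (\<lambda>n. map \<omega> [0..<n]) \<subseteq> {c. Ray \<omega> \<le> Vert c}" by auto
  ultimately have "infinite {c. Ray \<omega> \<le> Vert c}" using finite_subset by blast
  then show ?thesis by (simp add: dT_def del: less_eq_tbar.simps)
qed

abbreviation dV :: "vertex \<Rightarrow> nat" where
  "dV a \<equiv> the_enat (dT (Vert a))"

text \<open>The value of \<open>2 ^ (-n)\<close>, with the convention that it is 0 at infinity.\<close>

definition two_pow_minus :: "enat \<Rightarrow> real" where
  "two_pow_minus n = (case n of enat k \<Rightarrow> (1/2) ^ k | \<infinity> \<Rightarrow> 0)"

definition delta1 :: "tbar \<Rightarrow> tbar \<Rightarrow> real" where
  "delta1 \<alpha> \<beta> = two_pow_minus (dT (sup \<alpha> \<beta>))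
     - 1/2 * (two_pow_minus (dT \<alpha>) + two_pow_minus (dT \<beta>))"

definition delta :: "tbar ^ 'd \<Rightarrow> tbar ^ 'd \<Rightarrow> real" where
  "delta \<alpha> \<beta> = (\<Sum>j\<in>UNIV. delta1 (\<alpha> $ j) (\<beta> $ j))"

lemma two_pow_minus_simps [simp]:
  "two_pow_minus (enat n) = (1/2) ^ n" "two_pow_minus \<infinity> = 0"
  by (simp_all add: two_pow_minus_def)

lemma two_pow_minus_dT_mono:
  "\<alpha> \<le> \<beta> \<Longrightarrow> two_pow_minus (dT \<alpha>) \<le> two_pow_minus (dT \<beta>)"
  by (cases \<alpha>; cases \<beta>) (auto dest: prefix_length_le intro!: power_decreasing)

lemma two_pow_minus_dT_strict:
  assumes "\<alpha> \<le> \<beta>" "two_pow_minus (dT \<alpha>) = two_pow_minus (dT \<beta>)" shows "\<alpha> = \<beta>"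
proof (cases \<alpha>)
  case (Vert a)
  with assms obtain b where b: "\<beta> = Vert b" "prefix b a" by (cases \<beta>) auto
  with assms Vert have "(1/2::real) ^ Suc (length a) = (1/2) ^ Suc (length b)" by simp
  then have "length a = length b" by (subst (asm) power_inject_exp') auto
  with b Vert show ?thesis by (auto simp: prefix_def)
next
  case (Ray \<omega>)
  with assms show ?thesis by (cases \<beta>) auto
qed

lemma tbar_above_linear:
  fixes \<beta> :: tbar assumes "\<beta> \<le> \<gamma>" "\<beta> \<le> \<gamma>'" shows "\<gamma> \<le> \<gamma>' \<or> \<gamma>' \<le> \<gamma>"
proof (cases \<gamma>)
  case (Ray \<omega>) with assms show ?thesis by auto
next
  case (Vert c)
  show ?thesis
  proof (cases \<gamma>')
    case (Ray \<omega>) with assms show ?thesis by auto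
  next
    case (Vert c')
    with \<open>\<gamma> = Vert c\<close> assms le_Vert_chain[of \<beta> c c'] le_Vert_chain[of \<beta> c' c] show ?thesis
      by (meson less_eq_tbar.simps(1) linear)
  qed
qed

lemma Metric_space_delta1: "Metric_space UNIV delta1"
proof
  fix x y z :: tbar
  have sup_ge: "two_pow_minus (dT a) \<le> two_pow_minus (dT (sup a b))"
       "two_pow_minus (dT b) \<le> two_pow_minus (dT (sup a b))" for a b
    by (auto intro: two_pow_minus_dT_mono)
  show "0 \<le> delta1 x y" using sup_ge[where a=x and b=y] by (simp add: delta1_def)
  show "delta1 x y = delta1 y x" by (simp add: delta1_def sup_commute)
  show "delta1 x y = 0 \<longleftrightarrow> x = y"
  proof
    assume "delta1 x y = 0"
    with sup_ge[where a=x and b=y] have "two_pow_minus (dT x) = two_pow_minus (dT (sup x y))"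
      "two_pow_minus (dT y) = two_pow_minus (dT (sup x y))" by (auto simp: delta1_def)
    then have "x = sup x y" "y = sup x y"
      using two_pow_minus_dT_strict[OF sup_ge1] two_pow_minus_dT_strict[OF sup_ge2] by blast+
    then show "x = y" by metis
  qed (simp add: delta1_def)
  show "delta1 x z \<le> delta1 x y + delta1 y z"
  proof -
    have "sup x y \<le> sup y z \<or> sup y z \<le> sup x y" by (rule tbar_above_linear[of y]) auto
    then have "sup x z \<le> sup y z \<or> sup x z \<le> sup x y"
      by (metis le_sup_iff order_trans sup_ge1 sup_ge2)
    then have "two_pow_minus (dT (sup x z)) \<le> two_pow_minus (dT (sup y z)) \<or>
       two_pow_minus (dT (sup x z)) \<le> two_pow_minus (dT (sup x y))"
      by (auto intro: two_pow_minus_dT_mono)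
    with sup_ge[where a=x and b=y] sup_ge[where a=y and b=z] show ?thesis unfolding delta1_def by argo
  qed
qed

lemma Metric_space_delta: "Metric_space UNIV (delta :: tbar ^ 'd \<Rightarrow> tbar ^ 'd \<Rightarrow> real)"
proof -
  interpret Metric_space UNIV delta1 by (rule Metric_space_delta1)
  show ?thesis
  proof
    fix x y z :: "tbar ^ 'd"
    show "0 \<le> delta x y" by (simp add: delta_def sum_nonneg)
    show "delta x y = delta y x" by (simp add: delta_def commute)
    show "delta x y = 0 \<longleftrightarrow> x = y" by (simp add: delta_def sum_nonneg_eq_0_iff vec_eq_iff)
    show "delta x z \<le> delta x y + delta y z"
      unfolding delta_def sum.distrib[symmetric] by (intro sum_mono) (auto intro: triangle)
  qed
qed

definition metric_borel :: "('a \<Rightarrow> 'a \<Rightarrow> real) \<Rightarrow> 'a measure" where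
  "metric_borel \<rho> = sigma UNIV {U. openin (Metric_space.mtopology UNIV \<rho>) U}"

definition boundary_pow :: "(tbar ^ 'd) set" where
  "boundary_pow = {\<omega>. \<forall>j. \<omega> $ j \<in> boundary}"

definition verts :: "vertex ^ 'd \<Rightarrow> tbar ^ 'd" where
  "verts \<alpha> = (\<chi> j. Vert (\<alpha> $ j))"

definition Q1 :: "vertex \<Rightarrow> tbar set" where
  "Q1 a = {\<omega> \<in> boundary. \<omega> \<le> Vert a}"

definition Qd :: "vertex ^ 'd \<Rightarrow> (tbar ^ 'd) set" where
  "Qd \<alpha> = {\<omega> \<in> boundary_pow. \<omega> \<le> verts \<alpha>}"

definition is_canonical :: "tbar measure \<Rightarrow> bool" where
  "is_canonical N \<longleftrightarrow> sets N = sets (restrict_space (metric_borel delta1) boundary) \<and>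
     prob_space N \<and> (\<forall>a. measure N (Q1 a) = 2 powr (1 - real (dV a)))"

text \<open>\<open>ex1_canonical\<close> below shows that this description is proper.\<close>

definition canonical_M :: "tbar measure" where
  "canonical_M = (THE N. is_canonical N)"

lemma sets_metric_borel_open:
  assumes "Metric_space UNIV \<rho>"
  shows "sets (metric_borel \<rho>) = sigma_sets UNIV {U. openin (Metric_space.mtopology UNIV \<rho>) U}"
  by (simp add: metric_borel_def)

lemma space_metric_borel [simp]: "space (metric_borel \<rho>) = UNIV"
  by (simp add: metric_borel_def)

lemma Q1_open: "openin (Metric_space.mtopology UNIV delta1) {\<omega>. \<omega> \<le> Vert a}"
proof -
  interpret Metric_space UNIV delta1 by (rule Metric_space_delta1)
  have "\<exists>r>0. mball x r \<subseteq> {\<omega>. \<omega> \<le> Vert a}" if x: "x \<le> Vert a" for x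
  proof -
    have "y \<le> Vert a" if d: "delta1 x y < (1/2) ^ (length a + 2)" for y
    proof (rule ccontr)
      assume n: "\<not> y \<le> Vert a"
      let ?s = "sup x y"
      have ns: "\<not> ?s \<le> Vert a" using n by (auto dest: order_trans[OF sup_ge2])
      with x have s: "Vert a \<le> ?s" "Vert a \<noteq> ?s" using tbar_above_linear[of x "Vert a" ?s] by auto
      then obtain c where c: "?s = Vert c" "prefix c a" "c \<noteq> a" by (cases ?s) auto
      then have l: "length c < length a"
        using prefix_length_less[of c a] by (simp add: strict_prefix_def)
      have 1: "two_pow_minus (dT x) \<le> (1/2) ^ Suc (length a)"
        using two_pow_minus_dT_mono[OF x] by simp
      have 2: "(2::real) * (1/2) ^ Suc (length a) \<le> (1/2) ^ Suc (length c)"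
        using l power_decreasing[of "Suc (length c)" "length a" "1/2::real"] by simp
      have 3: "two_pow_minus (dT y) \<le> (1/2) ^ Suc (length c)"
        using two_pow_minus_dT_mono[OF sup_ge2[of y x]] unfolding c(1) by simp
      have e: "delta1 x y = (1/2) ^ Suc (length c) - 1/2 * (two_pow_minus (dT x) + two_pow_minus (dT y))"
        using c by (simp add: delta1_def)
      have 4: "(1/2::real) ^ (length a + 2) = 1/2 * (1/2) ^ Suc (length a)" by simp
      have "False" if "C - 1/2 * (X + Y) < 1/2 * A" "X \<le> A" "2 * A \<le> C" "Y \<le> C" for A C X Y :: real
        using that by argo
      from this[OF d[unfolded e 4] 1 2 3] show False .
    qed
    then show ?thesis by (intro exI[of _ "(1/2) ^ (length a + 2)"]) auto
  qed
  then show ?thesis by (auto simp: openin_mtopology)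
qed

lemma open_boundary_union:
  assumes "openin (Metric_space.mtopology UNIV delta1) U"
  shows "U \<inter> boundary = (\<Union>a\<in>{a. Q1 a \<subseteq> U}. Q1 a)"
proof -
  interpret Metric_space UNIV delta1 by (rule Metric_space_delta1)
  have "\<exists>a. Q1 a \<subseteq> U \<and> x \<in> Q1 a" if x: "x \<in> U" "x \<in> boundary" for x
  proof -
    obtain r where r: "r > 0" "mball x r \<subseteq> U" using assms x by (auto simp: openin_mtopology)
    obtain \<omega> where w: "x = Ray \<omega>" using x by (auto simp: boundary_def)
    obtain n where n: "(1/2::real) ^ n < r" using real_arch_pow_inv[of r "1/2"] r by auto
    let ?a = "map \<omega> [0..<n]"
    have "y \<in> U" if y: "y \<in> Q1 ?a" for y
    proof -
      from y have b: "sup x y \<le> Vert ?a" "y \<in> boundary" using w by (auto simp: Q1_def)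
      have "delta1 x y = two_pow_minus (dT (sup x y))" using w b by (auto simp: delta1_def boundary_def)
      also have "\<dots> \<le> (1/2) ^ Suc n" using two_pow_minus_dT_mono[OF b(1)] by simp
      also have "\<dots> \<le> (1/2) ^ n" by simp
      finally show ?thesis using n r by auto
    qed
    moreover have "x \<in> Q1 ?a" using w by (auto simp: Q1_def boundary_def)
    ultimately show ?thesis by blast
  qed
  then show ?thesis by (auto simp: Q1_def)
qed

lemma sets_boundary:
  "sets (restrict_space (metric_borel delta1) boundary) = sigma_sets boundary (range Q1)"
proof -
  let ?O = "{U. openin (Metric_space.mtopology UNIV delta1) U}"
  have "sets (restrict_space (metric_borel delta1) boundary) = ((\<inter>) boundary) ` sigma_sets UNIV ?O"
    by (simp add: sets_restrict_space sets_metric_borel_open[OF Metric_space_delta1])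
  also have "\<dots> = sigma_sets boundary (((\<inter>) boundary) ` ?O)"
  proof -
    have *: "{(\<lambda>x. x) -` A \<inter> boundary |A. A \<in> \<S>} = ((\<inter>) boundary) ` \<S>" for \<S> by auto
    show ?thesis
      using sigma_sets_vimage_commute[of "\<lambda>x. x" boundary UNIV ?O] unfolding * by simp
  qed
  also have "\<dots> = sigma_sets boundary (range Q1)"
  proof (rule sigma_sets_eqI)
    fix A assume "A \<in> ((\<inter>) boundary) ` ?O"
    then obtain U where "U \<in> ?O" "A = U \<inter> boundary" by auto
    then have A: "A = (\<Union>a\<in>{a. Q1 a \<subseteq> U}. Q1 a)" using open_boundary_union by auto
    interpret sigma_algebra boundary "sigma_sets boundary (range Q1)"
      by (rule sigma_algebra_sigma_sets) (auto simp: Q1_def)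
    show "A \<in> sigma_sets boundary (range Q1)" unfolding A
      by (rule countable_UN'') auto
  next
    fix B assume "B \<in> range Q1"
    then obtain a where "B = boundary \<inter> {\<omega>. \<omega> \<le> Vert a}" by (auto simp: Q1_def)
    then have "B \<in> ((\<inter>) boundary) ` ?O" using Q1_open[of a] by auto
    then show "B \<in> sigma_sets boundary (((\<inter>) boundary) ` ?O)" by auto
  qed
  finally show ?thesis .
qed

lemma Q1_Nil [simp]: "Q1 [] = boundary"
  by (auto simp: Q1_def boundary_def)

lemma ex_canonical: "\<exists>N. is_canonical N"
proof -
  let ?C = "\<lambda>_::nat. measure_pmf (bernoulli_pmf (1/2))"
  let ?B = "restrict_space (metric_borel delta1) boundary"
  interpret product_prob_space ?C UNIV by unfold_locales
  let ?P = "PiM UNIV ?C"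
  have sp: "space ?P = UNIV" by (simp add: space_PiM)
  have vim: "Ray -` Q1 a = {x. \<forall>i\<in>{..<length a}. x i \<in> {a ! i}}" for a
    by (auto simp: Q1_def boundary_def)
  have cyl: "{x. \<forall>i\<in>{..<length a}. x i \<in> {a ! i}} \<in> sets ?P" for a
  proof -
    have "{x. \<forall>i\<in>{..<length a}. x i \<in> {a ! i}} =
      prod_emb UNIV ?C {..<length a} (PiE {..<length a} (\<lambda>i. {a ! i}))"
      by (subst prod_emb_PiE) (simp_all add: PiE_UNIV_domain Pi_def set_eq_iff Ball_def split: if_splits)
    also have "\<dots> \<in> sets ?P" by (rule sets_PiM_I) auto
    finally show ?thesis .
  qed
  have em: "emeasure ?P (Ray -` Q1 a) = ennreal ((1/2) ^ length a)" for a
  proof -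
    have "emeasure ?P {x\<in>space ?P. \<forall>i\<in>{..<length a}. x i \<in> {a ! i}}
       = (\<Prod>i<length a. emeasure (?C i) {a ! i})"
      by (rule emeasure_PiM_Collect) auto
    also have "\<dots> = (\<Prod>i<length a. ennreal (1/2))"
    proof (rule prod.cong)
      fix i
      show "emeasure (?C i) {a ! i} = ennreal (1/2)"
        by (cases "a ! i") (simp_all add: emeasure_pmf_single)
    qed simp
    also have "\<dots> = ennreal ((1/2) ^ length a)"
      by (simp only: prod_constant card_lessThan) (rule ennreal_power, simp)
    finally show ?thesis unfolding sp vim by simp
  qed
  have space_B: "space ?B = boundary" by (simp add: space_restrict_space)
  have meas: "Ray \<in> measurable ?P ?B"
  proof (rule measurable_sigma_sets[OF sets_boundary])
    show "Ray -` A \<inter> space ?P \<in> sets ?P" if "A \<in> range Q1" for A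
      using that cyl unfolding sp by (auto simp only: vim Int_UNIV_right)
  qed (auto simp: Q1_def boundary_def)
  let ?N = "distr ?P ?B Ray"
  have Q1B: "Q1 a \<in> sets ?B" for a
    unfolding sets_boundary by (intro sigma_sets.Basic rangeI)
  have "measure ?N (Q1 a) = 2 powr (1 - real (dV a))" for a
  proof -
    have "emeasure ?N (Q1 a) = ennreal ((1/2) ^ length a)"
      using em[of a] by (subst emeasure_distr[OF meas Q1B]) (simp only: sp Int_UNIV_right)
    then have "measure ?N (Q1 a) = (1/2) ^ length a"
      by (subst measure_def) (simp only: enn2real_ennreal zero_le_power zero_le_divide_1_iff zero_le_numeral)
    also have "\<dots> = 2 powr (- real (length a))"
      by (simp only: powr_minus powr_realpow zero_less_numeral power_one_over inverse_eq_divide)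
    finally show ?thesis by simp
  qed
  moreover have "prob_space ?N" by (rule prob_space_distr[OF meas])
  moreover have "sets ?N = sets ?B" by (rule sets_distr)
  ultimately show ?thesis unfolding is_canonical_def by blast
qed

lemma ex1_canonical: "\<exists>!N. is_canonical N"
proof -
  have "N = N'" if N: "is_canonical N" and N': "is_canonical N'" for N N'
  proof (rule measure_eqI_generator_eq_countable)
    let ?E = "insert {} (range Q1)"
    have ps: "prob_space N" "prob_space N'" using N N' by (auto simp: is_canonical_def)
    have "Q1 a \<inter> Q1 b \<in> ?E" if l: "length a \<le> length b" for a b
    proof (cases "prefix a b")
      case True
      then have "Q1 b \<subseteq> Q1 a"
        unfolding Q1_def using order_trans[of _ "Vert b" "Vert a"] by auto
      then have "Q1 a \<inter> Q1 b = Q1 b" by auto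
      then show ?thesis by auto
    next
      case False
      then have "Q1 a \<inter> Q1 b = {}" using le_Vert_chain[OF _ _ l] by (auto simp: Q1_def)
      then show ?thesis by auto
    qed
    then have "Q1 a \<inter> Q1 b \<in> ?E" for a b by (metis Int_commute linear)
    then show "Int_stable ?E" by (auto simp: Int_stable_def)
    show "?E \<subseteq> Pow boundary" by (auto simp: Q1_def)
    show "emeasure N X = emeasure N' X" if "X \<in> ?E" for X
      using that N N' ps
      by (auto simp: is_canonical_def finite_measure.emeasure_eq_measure[OF prob_space.axioms(1)])
    have *: "sigma_sets boundary ?E = sigma_sets boundary (range Q1)"
      by (rule sigma_sets_eqI) (auto intro: sigma_sets.Empty)
    show "sets N = sigma_sets boundary ?E" "sets N' = sigma_sets boundary ?E"
      using N N' by (auto simp: is_canonical_def sets_boundary *)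
    show "{boundary} \<subseteq> ?E" using Q1_Nil by blast
    show "emeasure N a \<noteq> \<infinity>" for a
      using ps(1) by (simp add: finite_measure.emeasure_eq_measure[OF prob_space.axioms(1)])
  qed auto
  with ex_canonical show ?thesis by blast
qed

lemma is_canonical_M: "is_canonical canonical_M"
  unfolding canonical_M_def by (rule theI') (rule ex1_canonical)

lemma measure_canonical_M: "measure canonical_M (Q1 a) = 2 powr (1 - real (dV a))"
  using is_canonical_M by (simp add: is_canonical_def)

text \<open>A Borel measure on the \<open>d\<close>-th power of the boundary, and the same measure regarded as a
  measure on \<open>tbar ^ 'd\<close>.\<close>

definition boundary_borel_measure :: "(tbar ^ 'd) measure \<Rightarrow> bool" where
  "boundary_borel_measure \<mu> \<longleftrightarrow> sets \<mu> = sets (restrict_space (metric_borel delta) boundary_pow)"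

definition extend_measure_tbar :: "(tbar ^ 'd) measure \<Rightarrow> (tbar ^ 'd) measure" where
  "extend_measure_tbar \<mu> = distr \<mu> (metric_borel delta) (\<lambda>\<omega>. \<omega>)"

definition poly_weight :: "real ^ 'd \<Rightarrow> vertex ^ 'd \<Rightarrow> real" where
  "poly_weight s \<beta> = (\<Prod>j\<in>UNIV. 2 powr (s $ j * real (dV (\<beta> $ j))))"

definition hardy :: "(vertex ^ 'd \<Rightarrow> real) \<Rightarrow> (vertex ^ 'd \<Rightarrow> real) \<Rightarrow> tbar ^ 'd \<Rightarrow> ennreal" where
  "hardy \<pi> f \<alpha> = (\<Sum>\<^sub>\<infinity>\<gamma>\<in>{\<gamma>. \<alpha> \<le> verts \<gamma>}. ennreal (f \<gamma> * \<pi> \<gamma>))"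

definition trace_measure :: "(vertex ^ 'd \<Rightarrow> real) \<Rightarrow> (tbar ^ 'd) measure \<Rightarrow> bool" where
  "trace_measure \<pi> \<mu> \<longleftrightarrow>
     (\<exists>C::ennreal. C < \<infinity> \<and> (\<forall>f :: vertex ^ 'd \<Rightarrow> real. (\<forall>\<alpha>. 0 \<le> f \<alpha>) \<longrightarrow>
        (\<integral>\<^sup>+\<alpha>. (hardy \<pi> f \<alpha>)\<^sup>2 \<partial>extend_measure_tbar \<mu>)
          \<le> C * (\<Sum>\<^sub>\<infinity>\<alpha>\<in>UNIV. ennreal ((f \<alpha>)\<^sup>2 * \<pi> \<alpha>))))"

definition box02 :: "(real ^ 'd) set" where
  "box02 = {t. \<forall>j. t $ j \<in> {0..2}}"

definition increasing_each_var :: "(real ^ 'd \<Rightarrow> real) \<Rightarrow> bool" where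
  "increasing_each_var \<phi> \<longleftrightarrow>
     (\<forall>t\<in>box02. \<forall>j. mono_on {0..2} (\<lambda>u. \<phi> (\<chi> i. if i = j then u else t $ i)))"

end

theory Submission
  imports Defs
begin

text \<open>
  Comparing \<open>\<phi>\<close> with its values at the corners of dyadic boxes turns the integral condition into a
  bound, uniform in \<open>x\<close>, for the sum of \<open>\<pi>(\<gamma>) \<phi>(M(Q\<^sub>\<gamma>))\<close> over the ancestors \<open>\<gamma>\<close> of \<open>x\<close>. By the
  Cauchy--Schwarz inequality the square of the Hardy operator at \<open>x\<close> is then at most a constant
  times the sum of \<open>f(\<gamma>)\<^sup>2 \<pi>(\<gamma>) / \<phi>(M(Q\<^sub>\<gamma>))\<close> over these ancestors. Integrating in \<open>\<mu>\<close> multiplies each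
  summand by \<open>\<mu>(Q\<^sub>\<gamma>)\<close>, which cancels the denominator.
\<close>

section \<open>Infinite sums as integrals over a counting measure\<close>

text \<open>Makes the sums in \<open>hardy\<close> and \<open>trace_measure\<close> accessible to
  the Cauchy-Schwarz inequality and to interchange with integration; both sides are suprema of
  finite partial sums.\<close>

lemma infsum_eq_nn_integral_count_space:
  fixes f :: "'a \<Rightarrow> ennreal"
  assumes "countable A"
  shows "infsum f A = (\<integral>\<^sup>+x. f x \<partial>count_space A)"
proof -
  have sup: "infsum f A = (SUP F\<in>{F. finite F \<and> F \<subseteq> A}. sum f F)"
    by (rule nonneg_infsum_complete) simp
  \<comment> \<open>An increasing sequence of finite sets exhausting \<open>A\<close>: monotone
    convergence needs a sequence, while \<open>infsum\<close> is a supremum over all finite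
    subsets.\<close>
  define F where "F n = {a\<in>A. to_nat_on A a < n}" for n
  have fin: "finite (F n)" for n
  proof (rule inj_on_finite)
    show "inj_on (to_nat_on A) (F n)"
      using inj_on_to_nat_on[OF assms] by (rule inj_on_subset) (auto simp: F_def)
    show "to_nat_on A ` F n \<subseteq> {..<n}" by (auto simp: F_def)
  qed simp
  have part: "(\<integral>\<^sup>+x. f x * indicator B x \<partial>count_space A) = sum f B" if "finite B" "B \<subseteq> A" for B
    using that by (subst nn_integral_count_space'[of B]) auto
  have "(\<integral>\<^sup>+x. f x \<partial>count_space A) = (\<integral>\<^sup>+x. (SUP n. f x * indicator (F n) x) \<partial>count_space A)"
  proof (rule nn_integral_cong)
    fix x assume x: "x \<in> space (count_space A)"
    show "f x = (SUP n. f x * indicator (F n) x)"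
    proof (rule antisym)
      have "f x = f x * indicator (F (Suc (to_nat_on A x))) x" using x by (simp add: F_def)
      also have "\<dots> \<le> (SUP n. f x * indicator (F n) x)" by (rule SUP_upper) simp
      finally show "f x \<le> (SUP n. f x * indicator (F n) x)" .
      show "(SUP n. f x * indicator (F n) x) \<le> f x"
        by (intro SUP_least) (auto split: split_indicator)
    qed
  qed
  also have "\<dots> = (SUP n. \<integral>\<^sup>+x. f x * indicator (F n) x \<partial>count_space A)"
    by (intro nn_integral_monotone_convergence_SUP)
       (auto simp: incseq_def le_fun_def F_def split: split_indicator)
  also have "\<dots> = (SUP n. sum f (F n))"
    by (intro SUP_cong refl part fin) (auto simp: F_def)
  also have "\<dots> \<le> infsum f A"
    unfolding sup using fin by (intro SUP_least SUP_upper) (auto simp: F_def)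
  finally have ge: "(\<integral>\<^sup>+x. f x \<partial>count_space A) \<le> infsum f A" .
  have "sum f B \<le> (\<integral>\<^sup>+x. f x \<partial>count_space A)" if "finite B" "B \<subseteq> A" for B
    unfolding part[OF that, symmetric]
    by (intro nn_integral_mono) (auto split: split_indicator)
  then have "infsum f A \<le> (\<integral>\<^sup>+x. f x \<partial>count_space A)"
    unfolding sup by (intro SUP_least) auto
  with ge show ?thesis by (rule antisym[rotated])
qed

section \<open>Monotonicity and dyadic boxes\<close>

text \<open>Coordinates are switched from \<open>t\<close> to \<open>u\<close> one at a time. Every
  intermediate point stays in \<open>box02\<close>, so monotonicity in one variable applies at each
  switch.\<close>

lemma increasing_each_var_le:
  fixes \<phi> :: "real ^ 'd \<Rightarrow> real"
  assumes inc: "increasing_each_var \<phi>" and t: "t \<in> box02" and u: "u \<in> box02"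
    and le: "\<And>j. t $ j \<le> u $ j"
  shows "\<phi> t \<le> \<phi> u"
proof -
  define m where "m J = (\<chi> i. if i \<in> J then u $ i else t $ i)" for J
  have "\<phi> t \<le> \<phi> (m J)" if "finite J" for J
    using that
  proof (induction J rule: finite_induct)
    case empty
    then show ?case by (simp add: m_def)
  next
    case (insert k J)
    have "m J \<in> box02" using t u by (auto simp: box02_def m_def)
    then have "mono_on {0..2} (\<lambda>v. \<phi> (\<chi> i. if i = k then v else m J $ i))"
      using inc by (simp add: increasing_each_var_def)
    from mono_onD[OF this, of "t $ k" "u $ k"] t u le
    have "\<phi> (\<chi> i. if i = k then t $ k else m J $ i) \<le> \<phi> (\<chi> i. if i = k then u $ k else m J $ i)"
      by (auto simp: box02_def)
    moreover have "(\<chi> i. if i = k then t $ k else m J $ i) = m J"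
      using insert by (auto simp: m_def vec_eq_iff)
    moreover have "(\<chi> i. if i = k then u $ k else m J $ i) = m (insert k J)"
      using insert by (auto simp: m_def vec_eq_iff)
    ultimately show ?case using insert by simp
  qed
  from this[of UNIV] show ?thesis by (simp add: m_def)
qed

lemma emeasure_lborel_box_cart:
  fixes a b :: "real ^ 'd"
  assumes "\<And>j. a $ j \<le> b $ j"
  shows "emeasure lborel (box a b) = ennreal (\<Prod>j\<in>UNIV. b $ j - a $ j)"
proof -
  have ne: "cbox a b \<noteq> {}" using assms by (simp add: interval_ne_empty_cart)
  have "emeasure lborel (box a b) = emeasure lborel (cbox a b)"
    by (simp add: emeasure_lborel_box_eq emeasure_lborel_cbox_eq)
  also have "\<dots> = ennreal (measure lborel (cbox a b))"
    by (rule emeasure_eq_ennreal_measure) (simp add: emeasure_lborel_cbox_eq)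
  finally show ?thesis using content_cbox_cart[OF ne] by simp
qed

text \<open>The point at which the bound on \<open>\<mu>\<close> evaluates \<open>\<phi>\<close>:
  \<open>dV\<close> counts the root, so the exponent 1 - \<open>dV\<close> in M(Q_a) is minus the
  word length.\<close>

definition corner :: "vertex ^ 'd \<Rightarrow> real ^ 'd" where
  "corner \<gamma> = (\<chi> j. (1/2) ^ length (\<gamma> $ j))"

text \<open>A side at level n is the interval from 2^(-n) to 2^(1-n); over all n \<ge> 0 these fill
  [0,2] up to a null set. Open boxes make different levels disjoint.\<close>

definition dyadic_box :: "vertex ^ 'd \<Rightarrow> (real ^ 'd) set" where
  "dyadic_box \<gamma> = box (corner \<gamma>) (2 *\<^sub>R corner \<gamma>)"

lemma mem_dyadic_box:
  "t \<in> dyadic_box \<gamma> \<longleftrightarrow> (\<forall>j. (1/2) ^ length (\<gamma> $ j) < t $ j \<and> t $ j < 2 * (1/2) ^ length (\<gamma> $ j))"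
  by (simp add: dyadic_box_def corner_def mem_box_cart)

lemma emeasure_dyadic_box:
  "emeasure lborel (dyadic_box \<gamma>) = ennreal (\<Prod>j\<in>UNIV. corner \<gamma> $ j)"
  unfolding dyadic_box_def by (subst emeasure_lborel_box_cart) (auto simp: corner_def)

lemma measure_Q1_eq_corner: "(\<chi> j. measure canonical_M (Q1 (\<gamma> $ j))) = corner \<gamma>"
  by (simp add: corner_def vec_eq_iff measure_canonical_M powr_minus powr_realpow power_one_over
      inverse_eq_divide)

lemma corner_box02: "corner \<gamma> \<in> box02"
proof -
  have "(1/2::real) ^ n \<le> 2" for n
    using power_le_one[of "1/2::real" n] by linarith
  then show ?thesis by (simp add: box02_def corner_def)
qed

text \<open>For m < n the interval at level n ends at 2^(1-n) \<le> 2^(-m), where the one at level m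
  begins.\<close>

lemma dyadic_box_length_unique:
  assumes "t \<in> dyadic_box \<gamma>" "t \<in> dyadic_box \<gamma>'"
  shows "length (\<gamma> $ j) = length (\<gamma>' $ j)"
proof -
  have "\<not> m < n" if "(1/2) ^ m < x" "x < 2 * (1/2::real) ^ n" for m n x
  proof
    assume "m < n"
    then have "(1/2::real) ^ n \<le> (1/2) ^ Suc m" by (intro power_decreasing) auto
    with that show False by simp
  qed
  with assms show ?thesis unfolding mem_dyadic_box by (metis linorder_neqE_nat)
qed

section \<open>Sums over the ancestors of a point\<close>

text \<open>In each coordinate the ancestors of a point form a chain, which meets every level at
  most once.\<close>

lemma ancestor_eqI:
  assumes "x \<le> verts \<gamma>" "x \<le> verts \<gamma>'" "\<And>j. length (\<gamma> $ j) = length (\<gamma>' $ j)"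
  shows "\<gamma> = \<gamma>'"
proof -
  have "\<gamma> $ j = \<gamma>' $ j" for j
  proof -
    have "x $ j \<le> Vert (\<gamma> $ j)" "x $ j \<le> Vert (\<gamma>' $ j)"
      using assms(1,2) by (simp_all add: less_eq_vec_def verts_def)
    then have "prefix (\<gamma> $ j) (\<gamma>' $ j)" using le_Vert_chain assms(3)[of j] by simp
    then show ?thesis using assms(3)[of j] by (auto simp: prefix_def)
  qed
  then show ?thesis by (simp add: vec_eq_iff)
qed

text \<open>Along the ancestors of a fixed point the level determines the vertex, so the dyadic boxes are
  disjoint and the sum is a lower Riemann sum of the integral.\<close>

lemma weighted_ancestor_sum_le:
  fixes s :: "real ^ 'd" and \<phi> :: "real ^ 'd \<Rightarrow> real"
  assumes s: "\<And>j. 0 \<le> s $ j" and nn: "\<And>t. t \<in> box02 \<Longrightarrow> 0 \<le> \<phi> t"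
    and inc: "increasing_each_var \<phi>"
  shows "(\<integral>\<^sup>+\<gamma>. ennreal (poly_weight s \<gamma> * \<phi> (corner \<gamma>)) \<partial>count_space {\<gamma>. x \<le> verts \<gamma>})
    \<le> ennreal (\<Prod>j\<in>UNIV. 2 powr (1 + 2 * s $ j)) *
       (\<integral>\<^sup>+t\<in>box02. ennreal (\<phi> t / (\<Prod>j\<in>UNIV. (t $ j) powr (1 + s $ j))) \<partial>lebesgue)"
proof -
  let ?A = "{\<gamma>. x \<le> verts \<gamma>}" and ?C = "\<Prod>j\<in>UNIV. 2 powr (1 + 2 * s $ j)"
  let ?F = "\<lambda>t. ennreal (\<phi> t / (\<Prod>j\<in>UNIV. (t $ j) powr (1 + s $ j))) * indicator box02 t"
  \<comment> \<open>A lower bound for the integrand on the box: the numerator is taken at the lower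
    corner and the denominator at the upper one, since \<open>\<phi>\<close> and the powers with
    exponents 1 + s_j > 0 are increasing.\<close>
  define w where "w \<gamma> = \<phi> (corner \<gamma>) / (\<Prod>j\<in>UNIV. (2 * corner \<gamma> $ j) powr (1 + s $ j))"
    for \<gamma> :: "vertex ^ 'd"
  have cpos: "corner \<gamma> $ j > 0" for \<gamma> :: "vertex ^ 'd" and j by (simp add: corner_def)
  have w0: "0 \<le> w \<gamma>" for \<gamma>
    unfolding w_def using nn[OF corner_box02] by (intro divide_nonneg_nonneg prod_nonneg) auto
  \<comment> \<open>For a coordinate of length n the weight is 2^(s(n+1)), while side length over
    denominator is 2^(-n) / 2^((1-n)(1+s)) = 2^(sn-1-s). The quotient 2^(1+2s) does not depend on n,
    which gives \<open>?C\<close>.\<close>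
  have weight: "poly_weight s \<gamma> * \<phi> (corner \<gamma>) = ?C * (w \<gamma> * (\<Prod>j\<in>UNIV. corner \<gamma> $ j))" for \<gamma>
  proof -
    have e: "2 powr (s $ j * real (dV (\<gamma> $ j)))
      = 2 powr (1 + 2 * s $ j) * (corner \<gamma> $ j / (2 * corner \<gamma> $ j) powr (1 + s $ j))" for j
    proof -
      have c: "corner \<gamma> $ j = 2 powr (- real (length (\<gamma> $ j)))"
        by (simp add: corner_def powr_minus powr_realpow power_one_over inverse_eq_divide)
      have "2 * corner \<gamma> $ j = 2 powr (1 - real (length (\<gamma> $ j)))"
        unfolding c by (simp add: powr_diff powr_minus inverse_eq_divide)
      then show ?thesis unfolding c
        by (simp add: powr_powr flip: powr_add powr_diff) (simp add: algebra_simps)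
    qed
    show ?thesis
      unfolding poly_weight_def e w_def by (simp add: prod.distrib prod_dividef)
  qed
  have bound: "w \<gamma> \<le> \<phi> t / (\<Prod>j\<in>UNIV. (t $ j) powr (1 + s $ j))" "t \<in> box02"
    if t: "t \<in> dyadic_box \<gamma>" for \<gamma> t
  proof -
    have t': "corner \<gamma> $ j < t $ j" "t $ j < 2 * corner \<gamma> $ j" for j
      using t by (simp_all add: mem_dyadic_box corner_def)
    have "corner \<gamma> $ j \<le> 1" for j by (simp add: corner_def power_le_one)
    then have "0 \<le> t $ j \<and> t $ j \<le> 2" for j
      using t'[of j] cpos[of \<gamma> j] by (smt (verit))
    then show tb: "t \<in> box02" by (simp add: box02_def)
    have "\<phi> (corner \<gamma>) \<le> \<phi> t"
      using increasing_each_var_le[OF inc corner_box02 tb] t' by (auto intro: less_imp_le)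
    moreover have "(\<Prod>j\<in>UNIV. (t $ j) powr (1 + s $ j)) \<le> (\<Prod>j\<in>UNIV. (2 * corner \<gamma> $ j) powr (1 + s $ j))"
      using s order.strict_trans[OF cpos[of \<gamma>] t'(1)]
      by (intro prod_mono conjI powr_mono2) (auto intro: less_imp_le t'(2))
    moreover have "0 < (\<Prod>j\<in>UNIV. (t $ j) powr (1 + s $ j))"
    proof (intro prod_pos ballI)
      show "0 < (t $ j) powr (1 + s $ j)" for j
        using order.strict_trans[OF cpos[of \<gamma> j] t'(1)] by simp
    qed
    ultimately show "w \<gamma> \<le> \<phi> t / (\<Prod>j\<in>UNIV. (t $ j) powr (1 + s $ j))"
      unfolding w_def using nn[OF corner_box02[of \<gamma>]] by (intro frac_le) auto
  qed
  \<comment> \<open>Each summand becomes \<open>?C\<close> times the integral of the constant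
    \<open>w \<gamma>\<close> over its box, so that the sum can be moved under the integral.\<close>
  have "(\<integral>\<^sup>+\<gamma>. ennreal (poly_weight s \<gamma> * \<phi> (corner \<gamma>)) \<partial>count_space ?A)
    = (\<integral>\<^sup>+\<gamma>. ennreal ?C * (\<integral>\<^sup>+t. ennreal (w \<gamma>) * indicator (dyadic_box \<gamma>) t \<partial>lebesgue) \<partial>count_space ?A)"
  proof (rule nn_integral_cong)
    fix \<gamma> :: "vertex ^ 'd"
    have sets: "dyadic_box \<gamma> \<in> sets lborel" by (simp add: dyadic_box_def)
    have "(\<integral>\<^sup>+t. ennreal (w \<gamma>) * indicator (dyadic_box \<gamma>) t \<partial>lebesgue)
      = ennreal (w \<gamma>) * ennreal (\<Prod>j\<in>UNIV. corner \<gamma> $ j)"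
      by (simp only: nn_integral_completion nn_integral_cmult_indicator[OF sets] emeasure_dyadic_box)
    also have "ennreal ?C * \<dots> = ennreal (poly_weight s \<gamma> * \<phi> (corner \<gamma>))"
      unfolding weight using w0[of \<gamma>] cpos[of \<gamma>]
      by (simp add: ennreal_mult prod_nonneg less_imp_le)
    finally show "ennreal (poly_weight s \<gamma> * \<phi> (corner \<gamma>))
      = ennreal ?C * (\<integral>\<^sup>+t. ennreal (w \<gamma>) * indicator (dyadic_box \<gamma>) t \<partial>lebesgue)" by simp
  qed
  also have "\<dots> = ennreal ?C * (\<integral>\<^sup>+\<gamma>. (\<integral>\<^sup>+t. ennreal (w \<gamma>) * indicator (dyadic_box \<gamma>) t \<partial>lebesgue) \<partial>count_space ?A)"
    by (rule nn_integral_cmult) simp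
  also have "(\<integral>\<^sup>+\<gamma>. (\<integral>\<^sup>+t. ennreal (w \<gamma>) * indicator (dyadic_box \<gamma>) t \<partial>lebesgue) \<partial>count_space ?A)
    = (\<integral>\<^sup>+t. (\<integral>\<^sup>+\<gamma>. ennreal (w \<gamma>) * indicator (dyadic_box \<gamma>) t \<partial>count_space ?A) \<partial>lebesgue)"
  proof (rule nn_integral_count_space_nn_integral[symmetric])
    show "(\<lambda>t. ennreal (w \<gamma>) * indicator (dyadic_box \<gamma>) t) \<in> borel_measurable lebesgue" for \<gamma>
    proof -
      have [measurable]: "dyadic_box \<gamma> \<in> sets lebesgue" by (simp add: dyadic_box_def)
      show ?thesis by measurable
    qed
  qed simp
  also have "\<dots> \<le> (\<integral>\<^sup>+t. ?F t \<partial>lebesgue)"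
  proof (rule nn_integral_mono)
    fix t :: "real ^ 'd"
    show "(\<integral>\<^sup>+\<gamma>. ennreal (w \<gamma>) * indicator (dyadic_box \<gamma>) t \<partial>count_space ?A) \<le> ?F t"
    \<comment> \<open>At a fixed \<open>t\<close> at most one ancestor contributes, and
      \<open>bound\<close> controls its term.\<close>
    proof (cases "\<exists>\<gamma>\<in>?A. t \<in> dyadic_box \<gamma>")
      case True
      then obtain \<gamma> where g: "\<gamma> \<in> ?A" "t \<in> dyadic_box \<gamma>" by auto
      have "\<gamma>' = \<gamma>" if "\<gamma>' \<in> ?A" "t \<in> dyadic_box \<gamma>'" for \<gamma>'
        using that g dyadic_box_length_unique by (intro ancestor_eqI[of x]) auto
      then have "indicator (dyadic_box \<gamma>') t = (0 :: ennreal)" if "\<gamma>' \<in> ?A" "\<gamma>' \<notin> {\<gamma>}" for \<gamma>'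
        using that by (intro indicator_simps(2)) blast
      then have "(\<integral>\<^sup>+\<gamma>. ennreal (w \<gamma>) * indicator (dyadic_box \<gamma>) t \<partial>count_space ?A)
        = (\<Sum>\<gamma>\<in>{\<gamma>}. ennreal (w \<gamma>) * indicator (dyadic_box \<gamma>) t)"
        using g by (intro nn_integral_count_space') auto
      also have "\<dots> \<le> ?F t" using bound[OF g(2)] g by (auto intro: ennreal_leI)
      finally show ?thesis .
    next
      case False
      then have "(\<integral>\<^sup>+\<gamma>. ennreal (w \<gamma>) * indicator (dyadic_box \<gamma>) t \<partial>count_space ?A)
        = (\<integral>\<^sup>+\<gamma>. 0 \<partial>count_space ?A)"
        by (intro nn_integral_cong) auto
      then show ?thesis by simp
    qed
  qed
  finally show ?thesis by (simp add: mult_left_mono)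
qed

section \<open>Down-sets as Borel sets and their measure\<close>

text \<open>\<open>delta\<close> is a finite sum of nonnegative coordinate distances, hence
  dominates each of them; the least of the coordinate radii from \<open>Q1_open\<close> therefore
  serves as radius.\<close>

lemma down_set_open:
  fixes \<alpha> :: "vertex ^ 'd"
  shows "openin (Metric_space.mtopology UNIV delta) {x. x \<le> verts \<alpha>}"
proof -
  interpret D: Metric_space UNIV "delta :: tbar ^ 'd \<Rightarrow> _" by (rule Metric_space_delta)
  interpret E: Metric_space UNIV delta1 by (rule Metric_space_delta1)
  have "\<exists>r>0. D.mball x r \<subseteq> {x. x \<le> verts \<alpha>}" if x: "x \<le> verts \<alpha>" for x
  proof -
    have "\<exists>r>0. E.mball (x $ j) r \<subseteq> {\<omega>. \<omega> \<le> Vert (\<alpha> $ j)}" for j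
      using x Q1_open[of "\<alpha> $ j"] by (auto simp: E.openin_mtopology less_eq_vec_def verts_def)
    then obtain r where r: "\<And>j. r j > 0" "\<And>j. E.mball (x $ j) (r j) \<subseteq> {\<omega>. \<omega> \<le> Vert (\<alpha> $ j)}"
      by metis
    have "y \<le> verts \<alpha>" if y: "delta x y < Min (range r)" for y
    proof -
      have "y $ j \<le> Vert (\<alpha> $ j)" for j
      proof -
        have "delta1 (x $ j) (y $ j) \<le> delta x y"
          unfolding delta_def by (rule member_le_sum) auto
        also have "\<dots> < r j" using y by auto
        finally show ?thesis using r(2)[of j] by auto
      qed
      then show ?thesis by (simp add: less_eq_vec_def verts_def)
    qed
    moreover have "Min (range r) > 0" using r(1) by auto
    ultimately show ?thesis by (intro exI[of _ "Min (range r)"]) auto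
  qed
  then show ?thesis by (auto simp: D.openin_mtopology)
qed

lemma sets_down_set [measurable]: "{x. x \<le> verts \<alpha>} \<in> sets (metric_borel delta)"
  by (simp add: sets_metric_borel_open[OF Metric_space_delta] down_set_open)

text \<open>The extension is the push-forward along the inclusion, so only the boundary part of the
  down-set counts. This connects the final integral with the hypothesis on
  \<open>Qd\<close>.\<close>

lemma emeasure_extend_down_set:
  fixes \<mu> :: "(tbar ^ 'd) measure"
  assumes "boundary_borel_measure \<mu>"
  shows "emeasure (extend_measure_tbar \<mu>) {x. x \<le> verts \<alpha>} = emeasure \<mu> (Qd \<alpha>)"
proof -
  have sets: "sets \<mu> = sets (restrict_space (metric_borel delta) boundary_pow)"
    using assms by (simp add: boundary_borel_measure_def)
  have space: "space \<mu> = boundary_pow"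
    using sets_eq_imp_space_eq[OF sets] by (simp add: space_restrict_space)
  have "(\<lambda>\<omega>. \<omega>) \<in> \<mu> \<rightarrow>\<^sub>M metric_borel delta"
    by (subst measurable_cong_sets[OF sets refl]) (auto intro: measurable_restrict_space1)
  then have "emeasure (extend_measure_tbar \<mu>) {x. x \<le> verts \<alpha>}
    = emeasure \<mu> ((\<lambda>\<omega>. \<omega>) -` {x. x \<le> verts \<alpha>} \<inter> space \<mu>)"
    unfolding extend_measure_tbar_def by (rule emeasure_distr) (rule sets_down_set)
  also have "(\<lambda>\<omega>. \<omega>) -` {x. x \<le> verts \<alpha>} \<inter> space \<mu> = Qd \<alpha>" by (auto simp: space Qd_def)
  finally show ?thesis .
qed

section \<open>A weighted Cauchy-Schwarz inequality\<close>

text \<open>In \<open>ennreal\<close>, \<open>0 / 0 = 0\<close> and \<open>c / 0 = \<infinity>\<close> for \<open>c > 0\<close>, so the estimate remains valid at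
  ancestors where the weight \<open>g\<close> vanishes. The summand 1 keeps the right-hand side infinite when
  the sum of \<open>g\<close> is 0.\<close>

lemma weighted_Cauchy_Schwarz_count_space:
  fixes f g p :: "'a \<Rightarrow> real"
  assumes f: "\<And>x. 0 \<le> f x" and g: "\<And>x. 0 \<le> g x" and p: "\<And>x. 0 < p x"
  shows "(\<integral>\<^sup>+x. ennreal (f x * p x) \<partial>count_space A)\<^sup>2
    \<le> ((\<integral>\<^sup>+x. ennreal (p x * g x) \<partial>count_space A) + 1) *
       (\<integral>\<^sup>+x. ennreal ((f x)\<^sup>2 * p x) / ennreal (g x) \<partial>count_space A)"
    (is "?L \<le> (?K + 1) * ?R")
proof (cases "\<exists>x\<in>A. g x = 0 \<and> f x \<noteq> 0")
  case True
  then obtain x where x: "x \<in> A" "g x = 0" "f x \<noteq> 0" by auto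
  then have "0 < (f x)\<^sup>2 * p x" using p by simp
  then have "ennreal ((f x)\<^sup>2 * p x) / ennreal (g x) = \<top>"
    using x by (simp add: ennreal_divide_zero ennreal_eq_0_iff not_le)
  moreover have "ennreal ((f x)\<^sup>2 * p x) / ennreal (g x) \<le> ?R"
    by (rule nn_integral_ge_point) (fact x)
  ultimately have "?R = \<top>" by (simp add: top_unique)
  then show ?thesis by (simp add: ennreal_mult_top)
next
  case False
  \<comment> \<open>In this case \<open>f\<close> vanishes wherever \<open>g\<close> does, so the
    product of the two factors is \<open>f x * p x\<close> there as well, with the real convention
    \<open>p x / 0 = 0\<close>.\<close>
  let ?u = "\<lambda>x. ennreal (sqrt (p x * g x))" and ?v = "\<lambda>x. ennreal (f x * sqrt (p x / g x))"
  have "?L = (\<integral>\<^sup>+x. ?u x * ?v x \<partial>count_space A)\<^sup>2"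
  proof (intro arg_cong[where f = "\<lambda>z. z\<^sup>2"] nn_integral_cong)
    fix x assume "x \<in> space (count_space A)"
    with False g[of x] have "f x = 0 \<or> 0 < g x" by force
    then have "f x * p x = sqrt (p x * g x) * (f x * sqrt (p x / g x))"
      using p[of x] by (auto simp: real_sqrt_mult real_sqrt_divide)
    then show "ennreal (f x * p x) = ?u x * ?v x"
      using f[of x] g[of x] p[of x] by (simp flip: ennreal_mult)
  qed
  also have "\<dots> \<le> (\<integral>\<^sup>+x. ?u x ^ 2 \<partial>count_space A) * (\<integral>\<^sup>+x. ?v x ^ 2 \<partial>count_space A)"
    by (rule Cauchy_Schwarz_nn_integral) auto
  also have "(\<integral>\<^sup>+x. ?u x ^ 2 \<partial>count_space A) = ?K"
    using g p by (intro nn_integral_cong) (simp add: ennreal_power less_imp_le)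
  also have "(\<integral>\<^sup>+x. ?v x ^ 2 \<partial>count_space A) = ?R"
  proof (intro nn_integral_cong)
    fix x assume "x \<in> space (count_space A)"
    with False g[of x] have "f x = 0 \<or> 0 < g x" by force
    then show "?v x ^ 2 = ennreal ((f x)\<^sup>2 * p x) / ennreal (g x)"
      using f[of x] p[of x]
      by (auto simp: ennreal_power power_mult_distrib divide_ennreal)
  qed
  also have "?K * ?R \<le> (?K + 1) * ?R" by (intro mult_right_mono) auto
  finally show ?thesis .
qed

section \<open>Integration against the measure\<close>

theorem proposition4p1:
  fixes s :: "real ^ 'd" and \<phi> :: "real ^ 'd \<Rightarrow> real" and \<mu> :: "(tbar ^ 'd) measure"
  assumes "\<And>j. 0 \<le> s $ j" and "\<And>j. s $ j < 1"
    and "\<And>t. t \<in> box02 \<Longrightarrow> 0 \<le> \<phi> t"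
    and "increasing_each_var \<phi>"
    and "(\<integral>\<^sup>+t\<in>box02. ennreal (\<phi> t / (\<Prod>j\<in>UNIV. (t $ j) powr (1 + s $ j))) \<partial>lebesgue) < \<infinity>"
    and "boundary_borel_measure \<mu>"
    and "\<And>\<alpha>. emeasure \<mu> (Qd \<alpha>) \<le> ennreal (\<phi> (\<chi> j. measure canonical_M (Q1 (\<alpha> $ j))))"
  shows "trace_measure (poly_weight s) \<mu>"
proof -
  let ?\<pi> = "poly_weight s" and ?\<nu> = "extend_measure_tbar \<mu>"
  \<comment> \<open>The bound of \<open>weighted_ancestor_sum_le\<close>, which is uniform in
    \<open>x\<close>, plus the summand 1 of the Cauchy-Schwarz estimate.\<close>
  define K where "K = ennreal (\<Prod>j\<in>UNIV. 2 powr (1 + 2 * s $ j)) *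
    (\<integral>\<^sup>+t\<in>box02. ennreal (\<phi> t / (\<Prod>j\<in>UNIV. (t $ j) powr (1 + s $ j))) \<partial>lebesgue) + 1"
  have K: "K < \<infinity>" unfolding K_def using assms(5) by (simp add: ennreal_mult_less_top)
  have \<pi>: "0 < ?\<pi> \<gamma>" for \<gamma> unfolding poly_weight_def by (intro prod_pos) auto
  have \<phi>: "0 \<le> \<phi> (corner \<gamma>)" for \<gamma> by (rule assms(3)[OF corner_box02])
  have "(\<integral>\<^sup>+x. (hardy ?\<pi> f x)\<^sup>2 \<partial>?\<nu>) \<le> K * (\<Sum>\<^sub>\<infinity>\<alpha>\<in>UNIV. ennreal ((f \<alpha>)\<^sup>2 * ?\<pi> \<alpha>))"
    if f: "\<And>\<alpha>. 0 \<le> f \<alpha>" for f :: "vertex ^ 'd \<Rightarrow> real"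
  proof -
    define v where "v \<gamma> = ennreal ((f \<gamma>)\<^sup>2 * ?\<pi> \<gamma>) / ennreal (\<phi> (corner \<gamma>))" for \<gamma>
    have pointwise: "(hardy ?\<pi> f x)\<^sup>2
      \<le> K * (\<integral>\<^sup>+\<gamma>. v \<gamma> * indicator {x. x \<le> verts \<gamma>} x \<partial>count_space UNIV)" for x
    proof -
      have "(hardy ?\<pi> f x)\<^sup>2 = (\<integral>\<^sup>+\<gamma>. ennreal (f \<gamma> * ?\<pi> \<gamma>) \<partial>count_space {\<gamma>. x \<le> verts \<gamma>})\<^sup>2"
        unfolding hardy_def by (subst infsum_eq_nn_integral_count_space) simp_all
      also have "\<dots> \<le> ((\<integral>\<^sup>+\<gamma>. ennreal (?\<pi> \<gamma> * \<phi> (corner \<gamma>)) \<partial>count_space {\<gamma>. x \<le> verts \<gamma>}) + 1)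
          * (\<integral>\<^sup>+\<gamma>. v \<gamma> \<partial>count_space {\<gamma>. x \<le> verts \<gamma>})"
        unfolding v_def by (rule weighted_Cauchy_Schwarz_count_space[OF f \<phi> \<pi>])
      also have "\<dots> \<le> K * (\<integral>\<^sup>+\<gamma>. v \<gamma> \<partial>count_space {\<gamma>. x \<le> verts \<gamma>})"
        unfolding K_def
        by (intro mult_right_mono add_right_mono weighted_ancestor_sum_le assms(1,3,4)) auto
      \<comment> \<open>The dependence on \<open>x\<close> moves from the index set into an
        indicator, as the later interchange requires a fixed index set.\<close>
      also have "(\<integral>\<^sup>+\<gamma>. v \<gamma> \<partial>count_space {\<gamma>. x \<le> verts \<gamma>})
        = (\<integral>\<^sup>+\<gamma>. v \<gamma> * indicator {x. x \<le> verts \<gamma>} x \<partial>count_space UNIV)"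
        by (subst nn_integral_count_space_indicator) (auto intro!: nn_integral_cong split: split_indicator)
      finally show ?thesis .
    qed
    have [measurable]: "{x. x \<le> verts \<gamma>} \<in> sets ?\<nu>" for \<gamma>
      by (simp add: extend_measure_tbar_def sets_down_set)
    have summand_le: "v \<gamma> * emeasure \<mu> (Qd \<gamma>) \<le> ennreal ((f \<gamma>)\<^sup>2 * ?\<pi> \<gamma>)" for \<gamma>
    proof -
      have \<mu>: "emeasure \<mu> (Qd \<gamma>) \<le> ennreal (\<phi> (corner \<gamma>))"
        using assms(7)[of \<gamma>] by (simp add: measure_Q1_eq_corner)
      show ?thesis
      proof (cases "\<phi> (corner \<gamma>) = 0")
        \<comment> \<open>Here \<open>v \<gamma>\<close> may be \<infinity>, but the hypothesis on
          \<open>\<mu>\<close> forces \<open>emeasure \<mu> (Qd \<gamma>) = 0\<close>, and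
          \<infinity> * 0 = 0 in \<open>ennreal\<close>.\<close>
        case True
        with \<mu> show ?thesis by simp
      next
        case False
        have "v \<gamma> * emeasure \<mu> (Qd \<gamma>) \<le> v \<gamma> * ennreal (\<phi> (corner \<gamma>))"
          using \<mu> by (intro mult_left_mono) auto
        also have "\<dots> = ennreal ((f \<gamma>)\<^sup>2 * ?\<pi> \<gamma>)"
          unfolding v_def using False \<phi>[of \<gamma>] \<pi>[of \<gamma>]
          by (simp add: divide_ennreal flip: ennreal_mult)
        finally show ?thesis .
      qed
    qed
    have "(\<integral>\<^sup>+x. (hardy ?\<pi> f x)\<^sup>2 \<partial>?\<nu>)
      \<le> (\<integral>\<^sup>+x. K * (\<integral>\<^sup>+\<gamma>. v \<gamma> * indicator {x. x \<le> verts \<gamma>} x \<partial>count_space UNIV) \<partial>?\<nu>)"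
      by (intro nn_integral_mono pointwise)
    also have "\<dots> = (\<integral>\<^sup>+x. (\<integral>\<^sup>+\<gamma>. K * (v \<gamma> * indicator {x. x \<le> verts \<gamma>} x) \<partial>count_space UNIV) \<partial>?\<nu>)"
      by (simp add: nn_integral_cmult)
    \<comment> \<open>The index set \<open>vertex ^ 'd\<close> is countable, so sum and integral
      interchange for an arbitrary measure.\<close>
    also have "\<dots> = (\<integral>\<^sup>+\<gamma>. (\<integral>\<^sup>+x. K * (v \<gamma> * indicator {x. x \<le> verts \<gamma>} x) \<partial>?\<nu>) \<partial>count_space UNIV)"
      by (rule nn_integral_count_space_nn_integral) auto
    also have "\<dots> = (\<integral>\<^sup>+\<gamma>. K * (v \<gamma> * emeasure \<mu> (Qd \<gamma>)) \<partial>count_space UNIV)"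
      by (intro nn_integral_cong)
         (simp add: nn_integral_cmult nn_integral_cmult_indicator emeasure_extend_down_set[OF assms(6)])
    also have "\<dots> \<le> (\<integral>\<^sup>+\<gamma>. K * ennreal ((f \<gamma>)\<^sup>2 * ?\<pi> \<gamma>) \<partial>count_space UNIV)"
      by (intro nn_integral_mono mult_left_mono summand_le) auto
    also have "\<dots> = K * (\<Sum>\<^sub>\<infinity>\<alpha>\<in>UNIV. ennreal ((f \<alpha>)\<^sup>2 * ?\<pi> \<alpha>))"
      by (simp add: nn_integral_cmult infsum_eq_nn_integral_count_space)
    finally show ?thesis .
  qed
  with K show ?thesis unfolding trace_measure_def by blast
qed

end
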